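(* Let $A\in\mathbb{R}^{n\times n}$ be a symmetric positive definite matrix, let $b\in\mathbb{R}^n$ and $F=bb^T\in\mathbb{R}^{n\times n}$, and let $\mathscr{L}_A(X)=AX+XA^T$ for $X\in\mathbb{R}^{n\times n}$. Consider the matrix conjugate gradient method (MCG) applied, in exact arithmetic, to $\mathscr{L}_A(X)=F$ with initial estimate $X_0=0$, producing iterands $X_\ell,R_\ell,P_\ell$ ($\ell\ge 0$) and $W_\ell$ ($\ell\ge 1$). Then for all $\ell$ for which the respective iterand is defined, $$\mathrm{rank}(X_\ell)\le\kappa_{A,b},\quad \mathrm{rank}(R_\ell)\le\kappa_{A,b},\quad \mathrm{rank}(P_\ell)\le\kappa_{A,b},\quad \mathrm{rank}(W_\ell)\le\kappa_{A,b},$$ where $\kappa_{A,b}$ is the number of eigenspaces of $A$ in which $b$ has a nonzero component.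
   Context: Definition of $\kappa_{A,b}$: let $\kappa_A$ be the number of distinct eigenvalues of $A$, and for $s=1,\ldots,\kappa_A$ let $V_s$ be a matrix whose columns form an orthonormal basis of the eigenspace of $A$ corresponding to its $s$th largest distinct eigenvalue. Then $\kappa_{A,b}$ is the number of indices $s\in\{1,\ldots,\kappa_A\}$ with $\|V_s^Tb\|\neq0$. MCG algorithm (with $\langle M,N\rangle=\mathrm{trace}(M^TN)=\mathrm{vec}(M)^T\mathrm{vec}(N)$, i.e. standard conjugate gradients for the vectorized system, written in matrix form): given $X_0$, set $R_0=F-\mathscr{L}_A(X_0)$, $\rho_0=\langle R_0,R_0\rangle$, $P_0=R_0$. For $\ell=1,2,\ldots$ set $W_\ell=\mathscr{L}_A(P_{\ell-1})$, $\alpha_\ell=\rho_{\ell-1}/\langle W_\ell,P_{\ell-1}\rangle$, $X_\ell=X_{\ell-1}+\alpha_\ell P_{\ell-1}$, $R_\ell=R_{\ell-1}-\alpha_\ell W_\ell$, $\rho_\ell=\langle R_\ell,R_\ell\rangle$, $\beta_\ell=\rho_\ell/\rho_{\ell-1}$, $P_\ell=R_\ell+\beta_\ell P_{\ell-1}$. The step $\ell$ is carried out (and its iterands defined) as long as $\rho_{\ell-1}\neq0$, i.e. as long as the method has not yet converged. *)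

theory Defs
  imports "HOL-Analysis.Analysis"
begin

section \<open>Symmetric positive definite matrices and their eigenspaces\<close>

definition sym_pos_def :: "real^'n^'n \<Rightarrow> bool" where
  "sym_pos_def A \<longleftrightarrow> transpose A = A \<and> (\<forall>x. x \<noteq> 0 \<longrightarrow> x \<bullet> (A *v x) > 0)"

definition eigenspace :: "real^'n^'n \<Rightarrow> real \<Rightarrow> (real^'n) set" where
  "eigenspace A l = {v. A *v v = l *\<^sub>R v}"

definition eigenvalues :: "real^'n^'n \<Rightarrow> real set" where
  "eigenvalues A = {l. \<exists>v. v \<noteq> 0 \<and> A *v v = l *\<^sub>R v}"

definition num_eigenvalues :: "real^'n^'n \<Rightarrow> nat" where
  "num_eigenvalues A = card (eigenvalues A)"

text \<open>The \<open>s\<close>-th largest distinct eigenvalue, for \<open>s \<in> {1..num_eigenvalues A}\<close>; meaningful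
  because the set of eigenvalues is finite, see \<open>finite_eigenvalues\<close> below.\<close>

definition nth_eigenvalue :: "real^'n^'n \<Rightarrow> nat \<Rightarrow> real" where
  "nth_eigenvalue A s = rev (sorted_list_of_set (eigenvalues A)) ! (s - 1)"

text \<open>The number of columns of the eigenbasis matrices varies with the eigenvalue, so such a
  matrix is represented by the list of its columns.\<close>

definition orthonormal_basis :: "(real^'n) list \<Rightarrow> (real^'n) set \<Rightarrow> bool" where
  "orthonormal_basis V S \<longleftrightarrow>
     (\<forall>i<length V. \<forall>j<length V. V ! i \<bullet> V ! j = (if i = j then 1 else 0)) \<and>
     span (set V) = S"

text \<open>The Euclidean norm of \<open>V\<^sup>T b\<close>, whose \<open>i\<close>-th entry is the inner product of the
  \<open>i\<close>-th column of \<open>V\<close> with \<open>b\<close>.\<close>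

definition norm_transpose_mult :: "(real^'n) list \<Rightarrow> real^'n \<Rightarrow> real" where
  "norm_transpose_mult V b = L2_set (\<lambda>i. V ! i \<bullet> b) {..<length V}"

definition eigenbases :: "real^'n^'n \<Rightarrow> (nat \<Rightarrow> (real^'n) list) \<Rightarrow> bool" where
  "eigenbases A V \<longleftrightarrow>
     (\<forall>s\<in>{1..num_eigenvalues A}. orthonormal_basis (V s) (eigenspace A (nth_eigenvalue A s)))"

definition kappa :: "real^'n^'n \<Rightarrow> (nat \<Rightarrow> (real^'n) list) \<Rightarrow> real^'n \<Rightarrow> nat" where
  "kappa A V b = card {s \<in> {1..num_eigenvalues A}. norm_transpose_mult (V s) b \<noteq> 0}"


section \<open>The matrix conjugate gradient method\<close>

definition lyap :: "real^'n^'n \<Rightarrow> real^'n^'n \<Rightarrow> real^'n^'n" where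
  "lyap A X = A ** X + X ** transpose A"

definition minner :: "real^'n^'n \<Rightarrow> real^'n^'n \<Rightarrow> real" where
  "minner M N = trace (transpose M ** N)"

text \<open>The arguments are the matrix \<open>A\<close>, the right-hand side \<open>F\<close>, the initial estimate and the
  iteration index.  The values at index \<open>0\<close> of \<open>mcg_W\<close>, \<open>mcg_alpha\<close> and \<open>mcg_beta\<close> are left
  unspecified.  The recursion is total (division by zero yields zero); an iterand of index
  \<open>l\<close> is produced by the method only if \<open>mcg_defined\<close> holds for \<open>l\<close>.\<close>

function (sequential) mcg_X :: "real^'n^'n \<Rightarrow> real^'n^'n \<Rightarrow> real^'n^'n \<Rightarrow> nat \<Rightarrow> real^'n^'n"
  and mcg_R :: "real^'n^'n \<Rightarrow> real^'n^'n \<Rightarrow> real^'n^'n \<Rightarrow> nat \<Rightarrow> real^'n^'n"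
  and mcg_P :: "real^'n^'n \<Rightarrow> real^'n^'n \<Rightarrow> real^'n^'n \<Rightarrow> nat \<Rightarrow> real^'n^'n"
  and mcg_W :: "real^'n^'n \<Rightarrow> real^'n^'n \<Rightarrow> real^'n^'n \<Rightarrow> nat \<Rightarrow> real^'n^'n"
  and mcg_rho :: "real^'n^'n \<Rightarrow> real^'n^'n \<Rightarrow> real^'n^'n \<Rightarrow> nat \<Rightarrow> real"
  and mcg_alpha :: "real^'n^'n \<Rightarrow> real^'n^'n \<Rightarrow> real^'n^'n \<Rightarrow> nat \<Rightarrow> real"
  and mcg_beta :: "real^'n^'n \<Rightarrow> real^'n^'n \<Rightarrow> real^'n^'n \<Rightarrow> nat \<Rightarrow> real"
where
  "mcg_X A F X0 0 = X0"
| "mcg_X A F X0 (Suc l) = mcg_X A F X0 l + mcg_alpha A F X0 (Suc l) *\<^sub>R mcg_P A F X0 l"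
| "mcg_R A F X0 0 = F - lyap A X0"
| "mcg_R A F X0 (Suc l) = mcg_R A F X0 l - mcg_alpha A F X0 (Suc l) *\<^sub>R mcg_W A F X0 (Suc l)"
| "mcg_P A F X0 0 = mcg_R A F X0 0"
| "mcg_P A F X0 (Suc l) = mcg_R A F X0 (Suc l) + mcg_beta A F X0 (Suc l) *\<^sub>R mcg_P A F X0 l"
| "mcg_W A F X0 (Suc l) = lyap A (mcg_P A F X0 l)"
| "mcg_rho A F X0 l = minner (mcg_R A F X0 l) (mcg_R A F X0 l)"
| "mcg_alpha A F X0 (Suc l) =
     mcg_rho A F X0 l / minner (mcg_W A F X0 (Suc l)) (mcg_P A F X0 l)"
| "mcg_beta A F X0 (Suc l) = mcg_rho A F X0 (Suc l) / mcg_rho A F X0 l"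

  by pat_completeness auto

text \<open>Within a step the order of computation is \<open>W\<close>, \<open>alpha\<close>, \<open>X\<close> and \<open>R\<close>, \<open>rho\<close>, \<open>beta\<close>, \<open>P\<close>.\<close>

termination
  by (relation "Wellfounded.measure (\<lambda>x. case x of
        Inl (Inl (A, F, X0, l)) \<Rightarrow> 6 * l + 2
      | Inl (Inr (Inl (A, F, X0, l))) \<Rightarrow> 6 * l + 2
      | Inl (Inr (Inr (A, F, X0, l))) \<Rightarrow> 6 * l + 5
      | Inr (Inl (Inl (A, F, X0, l))) \<Rightarrow> 6 * l
      | Inr (Inl (Inr (A, F, X0, l))) \<Rightarrow> 6 * l + 3
      | Inr (Inr (Inl (A, F, X0, l))) \<Rightarrow> 6 * l + 1
      | Inr (Inr (Inr (A, F, X0, l))) \<Rightarrow> 6 * l + 4)") simp_all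

definition mcg_defined :: "real^'n^'n \<Rightarrow> real^'n^'n \<Rightarrow> real^'n^'n \<Rightarrow> nat \<Rightarrow> bool" where
  "mcg_defined A F X0 l \<longleftrightarrow> (\<forall>k<l. mcg_rho A F X0 k \<noteq> 0)"


section \<open>Finiteness of the spectrum and existence of eigenbases\<close>

lemma finite_eigenvalues:
  fixes A :: "real^'n^'n"
  assumes "transpose A = A"
  shows "finite (eigenvalues A)"
proof -
  obtain v where v: "\<And>l. l \<in> eigenvalues A \<Longrightarrow> v l \<noteq> 0 \<and> A *v v l = l *\<^sub>R v l"
    using bchoice[of "eigenvalues A" "\<lambda>l v. v \<noteq> 0 \<and> A *v v = l *\<^sub>R v"]
    unfolding eigenvalues_def by blast
  have orth: "v k \<bullet> v l = 0" if "k \<in> eigenvalues A" "l \<in> eigenvalues A" "k \<noteq> l" for k l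
  proof -
    have "k * (v k \<bullet> v l) = (A *v v k) \<bullet> v l"
      using v that by simp
    also have "\<dots> = v k \<bullet> (A *v v l)"
      by (metis assms dot_lmul_matrix inner_commute transpose_matrix_vector)
    also have "\<dots> = l * (v k \<bullet> v l)"
      using v that by simp
    finally show ?thesis using that by simp
  qed
  have inj: "inj_on v (eigenvalues A)"
    by (rule inj_onI) (metis inner_eq_zero_iff orth v)
  have "pairwise orthogonal (v ` eigenvalues A)"
    unfolding pairwise_def orthogonal_def by (metis imageE orth)
  moreover have "0 \<notin> v ` eigenvalues A"
    using v by force
  ultimately have "finite (v ` eigenvalues A)"
    using pairwise_orthogonal_independent independent_imp_finite by blast
  then show ?thesis using inj finite_imageD by blast
qed

lemma ex_orthonormal_basis:
  fixes S :: "(real^'n) set"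
  assumes "subspace S"
  shows "\<exists>V. orthonormal_basis V S"
proof -
  obtain B where B: "B \<subseteq> S" "pairwise orthogonal B" "\<And>x. x \<in> B \<Longrightarrow> norm x = 1"
    "independent B" "span B = S"
    using orthonormal_basis_subspace[OF assms] by metis
  obtain V where V: "set V = B" "distinct V"
    using independent_imp_finite[OF B(4)] finite_distinct_list by blast
  have "V ! i \<bullet> V ! j = (if i = j then 1 else 0)" if "i < length V" "j < length V" for i j
    using that B(2,3) V unfolding pairwise_def orthogonal_def
    by (auto simp: nth_eq_iff_index_eq dot_square_norm)
  then show ?thesis
    using V B(5) unfolding orthonormal_basis_def by blast
qed

lemma ex_eigenbases: "\<exists>V. eigenbases A V"
proof -
  have "subspace (eigenspace A l)" for l
    unfolding eigenspace_def subspace_def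
    by (auto simp: matrix_vector_right_distrib matrix_vector_mult_scaleR scaleR_add_right)
  then have "\<forall>s. \<exists>W. orthonormal_basis W (eigenspace A (nth_eigenvalue A s))"
    using ex_orthonormal_basis by blast
  then obtain V where "\<forall>s. orthonormal_basis (V s) (eigenspace A (nth_eigenvalue A s))"
    using choice[of "\<lambda>s W. orthonormal_basis W (eigenspace A (nth_eigenvalue A s))"] by blast
  then show ?thesis
    unfolding eigenbases_def by blast
qed

end

theory Submission
  imports Defs
begin

text \<open>
  All iterands live in one fixed space of dimension at most \<open>kappa A V b\<close>.  Let \<open>U\<close> be the span of
  the orthogonal projections of \<open>b\<close> onto those eigenspaces of \<open>A\<close> to which \<open>b\<close> is not orthogonal.
  There are \<open>kappa A V b\<close> of these projections and each is an eigenvector, so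
  \<open>dim U \<le> kappa A V b\<close> and \<open>A\<close> maps \<open>U\<close> into itself.  As \<open>A\<close> is symmetric, eigenvectors span the
  whole space, so \<open>b\<close> is the sum of its projections and lies in \<open>U\<close>
  (\<open>ex_invariant_subspace_dim_le_kappa\<close>).

  A matrix whose columns lie in \<open>U\<close> has rank at most \<open>dim U\<close>, and these matrices form a linear space.
  It contains the initial estimate \<open>0\<close> and \<open>F = b b\<^sup>T\<close>, and \<open>lyap A\<close> preserves it: \<open>A X\<close> has its columns in \<open>U\<close> by invariance,
  and the columns of \<open>X A\<^sup>T\<close> are combinations of those of \<open>X\<close>.  The method only forms linear
  combinations and applies \<open>lyap A\<close>, hence never leaves this space (\<open>mcg_columns_in\<close>).
\<close>

section \<open>Eigenvectors of a symmetric matrix\<close>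

lemma inner_symmetric_matrix:
  fixes A :: "real^'n^'n"
  assumes "transpose A = A"
  shows "(A *v x) \<bullet> y = x \<bullet> (A *v y)"
  by (metis assms dot_lmul_matrix inner_commute transpose_matrix_vector)

lemma eigenspaces_orthogonal:
  fixes A :: "real^'n^'n"
  assumes "transpose A = A" "x \<in> eigenspace A k" "y \<in> eigenspace A l" "k \<noteq> l"
  shows "x \<bullet> y = 0"
  using inner_symmetric_matrix[OF assms(1), of x y] assms(2-4)
  by (simp add: eigenspace_def)

text \<open>
  The eigenvector maximizes the Rayleigh quotient on \<open>S\<close>: at a maximizer the first variation in each
  direction of \<open>S\<close> vanishes, so \<open>A v - l v\<close> is orthogonal to \<open>S\<close>, while it lies in \<open>S\<close> by invariance.
\<close>

lemma symmetric_matrix_ex_eigenvector_in: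
  fixes A :: "real^'n^'n"
  assumes sym: "transpose A = A" and S: "subspace S"
    and inv: "\<And>x. x \<in> S \<Longrightarrow> A *v x \<in> S"
    and nz: "x0 \<in> S" "x0 \<noteq> 0"
  shows "\<exists>v\<in>S. \<exists>l. v \<noteq> 0 \<and> A *v v = l *\<^sub>R v"
proof -
  let ?q = "\<lambda>x. x \<bullet> (A *v x)"
  have "compact (S \<inter> sphere 0 1)"
    using closed_subspace[OF S] by (simp add: closed_Int_compact)
  moreover have "x0 /\<^sub>R norm x0 \<in> S \<inter> sphere 0 1"
    using nz S by (simp add: subspace_scale)
  moreover have "continuous_on (S \<inter> sphere 0 1) ?q"
    by (intro continuous_intros linear_continuous_on matrix_vector_mul_bounded_linear)
  ultimately obtain v where v: "v \<in> S" "norm v = 1"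
    and max: "\<And>y. y \<in> S \<Longrightarrow> norm y = 1 \<Longrightarrow> ?q y \<le> ?q v"
    using continuous_attains_sup[of "S \<inter> sphere 0 1" ?q] by fastforce
  define l where "l = ?q v"
  have bound: "?q y \<le> l * (y \<bullet> y)" if "y \<in> S" for y
  proof (cases "y = 0")
    case False
    have "?q (y /\<^sub>R norm y) \<le> l"
      unfolding l_def using that False S by (intro max) (simp_all add: subspace_scale)
    then show ?thesis
      using False
      by (simp add: matrix_vector_mult_scaleR dot_square_norm field_simps power2_eq_square)
  qed simp
  have orth: "w \<bullet> (A *v v - l *\<^sub>R v) = 0" if w: "w \<in> S" for w
  proof (rule ccontr)
    define c where "c = w \<bullet> (A *v v - l *\<^sub>R v)"
    define d where "d = l * (w \<bullet> w) - ?q w"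
    assume "w \<bullet> (A *v v - l *\<^sub>R v) \<noteq> 0"
    then have c: "c \<noteq> 0" by (simp add: c_def)
    have le: "2 * t * c \<le> t\<^sup>2 * d" for t
    proof -
      have "?q (v + t *\<^sub>R w) \<le> l * ((v + t *\<^sub>R w) \<bullet> (v + t *\<^sub>R w))"
        using v w S by (intro bound) (simp add: subspace_add subspace_scale)
      moreover have "v \<bullet> (A *v w) = w \<bullet> (A *v v)"
        by (metis inner_symmetric_matrix[OF sym] inner_commute)
      moreover have "v \<bullet> v = 1" using v by (simp add: dot_square_norm)
      ultimately show ?thesis
        by (simp add: c_def d_def l_def[symmetric] matrix_vector_right_distrib
            matrix_vector_mult_scaleR inner_add inner_diff_right inner_commute[of v w]
            algebra_simps power2_eq_square)
    qed
    have d: "d \<ge> 0" using bound[OF w] by (simp add: d_def)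
    \<comment> \<open>For small \<open>t\<close> of the sign of \<open>c\<close> the linear term wins; \<open>t = c / (d + 1)\<close> is small enough.\<close>
    have "2 * c\<^sup>2 / (d + 1) \<le> c\<^sup>2 / (d + 1) * (d / (d + 1))"
      using le[of "c / (d + 1)"] by (simp add: power2_eq_square)
    also have "\<dots> \<le> c\<^sup>2 / (d + 1) * 1"
      using d by (intro mult_left_mono) auto
    finally have "c\<^sup>2 / (d + 1) \<le> 0" by simp
    moreover have "c\<^sup>2 / (d + 1) > 0" using c d by simp
    ultimately show False by simp
  qed
  have "A *v v - l *\<^sub>R v \<in> S"
    using v inv S by (simp add: subspace_diff subspace_scale)
  then have "A *v v = l *\<^sub>R v"
    using orth by (metis eq_iff_diff_eq_0 inner_eq_zero_iff)
  moreover have "v \<noteq> 0" using v by auto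
  ultimately show ?thesis using v by blast
qed

text \<open>
  This is the spectral theorem in the form needed here: the orthogonal complement of all eigenvectors
  is invariant, so it would contain a further eigenvector if it were nonzero.
\<close>

lemma orthogonal_to_eigenspaces_eq_0:
  fixes A :: "real^'n^'n"
  assumes sym: "transpose A = A"
    and orth: "\<And>l v. v \<in> eigenspace A l \<Longrightarrow> v \<bullet> x = 0"
  shows "x = 0"
proof (rule ccontr)
  assume "x \<noteq> 0"
  let ?S = "{y. \<forall>l. \<forall>v\<in>eigenspace A l. v \<bullet> y = 0}"
  have "subspace ?S"
    by (auto simp: subspace_def inner_add_right)
  moreover have "A *v y \<in> ?S" if "y \<in> ?S" for y
  proof -
    have "v \<bullet> (A *v y) = l * (v \<bullet> y)" if "v \<in> eigenspace A l" for v l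
      using that by (simp add: inner_symmetric_matrix[OF sym, symmetric] eigenspace_def)
    then show ?thesis using that by simp
  qed
  moreover have "x \<in> ?S" using orth by blast
  ultimately obtain v l where "v \<in> ?S" "v \<noteq> 0" "A *v v = l *\<^sub>R v"
    using symmetric_matrix_ex_eigenvector_in[OF sym, of ?S x] \<open>x \<noteq> 0\<close> by blast
  then have "v \<bullet> v = 0" by (auto simp: eigenspace_def)
  then show False using \<open>v \<noteq> 0\<close> by simp
qed


section \<open>An invariant subspace of small dimension\<close>

lemma nth_eigenvalue_bij:
  assumes "finite (eigenvalues A)"
  shows "bij_betw (nth_eigenvalue A) {1..num_eigenvalues A} (eigenvalues A)"
proof -
  let ?L = "rev (sorted_list_of_set (eigenvalues A))"
  have "bij_betw ((!) ?L) {..<num_eigenvalues A} (eigenvalues A)"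
    using assms by (intro bij_betw_nth) (auto simp: num_eigenvalues_def)
  moreover have "bij_betw (\<lambda>s. s - 1) {1..num_eigenvalues A} {..<num_eigenvalues A}"
    by (rule bij_betwI[of _ _ _ Suc]) auto
  ultimately have "bij_betw ((!) ?L \<circ> (\<lambda>s. s - 1)) {1..num_eigenvalues A} (eigenvalues A)"
    using bij_betw_trans by blast
  then show ?thesis
    by (simp add: nth_eigenvalue_def[abs_def] comp_def)
qed

lemma norm_transpose_mult_eq_0_iff:
  assumes "orthonormal_basis V S"
  shows "norm_transpose_mult V b = 0 \<longleftrightarrow> (\<forall>x\<in>S. x \<bullet> b = 0)"
proof -
  have "norm_transpose_mult V b = 0 \<longleftrightarrow> (\<forall>x\<in>set V. x \<bullet> b = 0)"
    by (auto simp: norm_transpose_mult_def L2_set_eq_0_iff all_set_conv_all_nth)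
  also have "\<dots> \<longleftrightarrow> (\<forall>x\<in>span (set V). x \<bullet> b = 0)"
    using orthogonal_to_span[of _ "set V" b]
    by (auto simp: orthogonal_def inner_commute span_base)
  finally show ?thesis using assms by (simp add: orthonormal_basis_def)
qed

lemma ex_invariant_subspace_dim_le_kappa:
  fixes A :: "real^'n^'n"
  assumes sym: "transpose A = A" and V: "eigenbases A V"
  obtains U where "subspace U" "\<And>x. x \<in> U \<Longrightarrow> A *v x \<in> U" "b \<in> U" "dim U \<le> kappa A V b"
proof -
  let ?N = "{1..num_eigenvalues A}"
  let ?E = "\<lambda>s. eigenspace A (nth_eigenvalue A s)"
  define K where "K = {s \<in> ?N. norm_transpose_mult (V s) b \<noteq> 0}"
  have basis: "orthonormal_basis (V s) (?E s)" if "s \<in> ?N" for s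
    using V that by (simp add: eigenbases_def)
  have bij: "bij_betw (nth_eigenvalue A) ?N (eigenvalues A)"
    by (rule nth_eigenvalue_bij[OF finite_eigenvalues[OF sym]])
  have "\<exists>y. y \<in> ?E s \<and> (\<forall>w\<in>?E s. w \<bullet> (b - y) = 0)" if "s \<in> ?N" for s
  proof -
    have "span (?E s) = ?E s"
      using basis[OF that] by (metis orthonormal_basis_def span_span)
    then show ?thesis
      using orthogonal_subspace_decomp_exists[of "?E s" b]
      by (metis add_diff_cancel_left' inner_commute orthogonal_def)
  qed
  then obtain p where p: "\<And>s. s \<in> ?N \<Longrightarrow> p s \<in> ?E s"
    and proj: "\<And>s w. s \<in> ?N \<Longrightarrow> w \<in> ?E s \<Longrightarrow> w \<bullet> b = w \<bullet> p s"
    unfolding inner_diff_right by (metis eq_iff_diff_eq_0)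
  have finK: "finite K" and KN: "K \<subseteq> ?N" by (auto simp: K_def)
  let ?U = "span (p ` K)"
  \<comment> \<open>An eigenvector sees only the projection onto its own eigenspace; for an eigenspace outside \<open>K\<close>
    it is orthogonal to \<open>b\<close>, so leaving that projection out of the sum does no harm.\<close>
  have "w \<bullet> (b - sum p K) = 0" if w: "w \<in> eigenspace A l" for l w
  proof (cases "w = 0")
    case False
    then have "l \<in> eigenvalues A"
      using w by (auto simp: eigenvalues_def eigenspace_def)
    then obtain t where t: "t \<in> ?N" "l = nth_eigenvalue A t"
      using bij by (metis bij_betw_imp_surj_on imageE)
    have "w \<bullet> p s = 0" if "s \<in> K" "s \<noteq> t" for s
    proof (rule eigenspaces_orthogonal[OF sym w p])
      show "l \<noteq> nth_eigenvalue A s"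
        using that t KN bij by (metis bij_betw_imp_inj_on inj_onD subsetD)
    qed (use that KN in blast)
    then have "w \<bullet> sum p K = (\<Sum>s\<in>K. if s = t then w \<bullet> p t else 0)"
      unfolding inner_sum_right by (intro sum.cong) auto
    also have "\<dots> = (if t \<in> K then w \<bullet> p t else 0)"
      using finK by simp
    also have "\<dots> = w \<bullet> b"
      using t w proj[of t w] norm_transpose_mult_eq_0_iff[OF basis, of t b]
      by (auto simp: K_def)
    finally show ?thesis by (simp add: inner_diff_right)
  qed simp
  then have "b = sum p K"
    using orthogonal_to_eigenspaces_eq_0[OF sym] by (metis eq_iff_diff_eq_0)
  then have "b \<in> ?U"
    by (simp add: span_sum span_base)
  moreover have "A *v x \<in> ?U" if "x \<in> ?U" for x
    using that
  proof (induction rule: span_induct_alt)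
    case (step c y z)
    then have "A *v y \<in> ?U"
      using p KN by (fastforce simp: eigenspace_def intro: span_scale span_base)
    then show ?case
      using step by (simp add: matrix_vector_right_distrib matrix_vector_mult_scaleR
          span_add span_scale)
  qed (simp add: span_zero)
  moreover have "dim ?U \<le> kappa A V b"
    using dim_le_card'[of "p ` K"] card_image_le[OF finK, of p] finK
    by (simp add: dim_span kappa_def K_def)
  ultimately show ?thesis
    using that[of ?U] by simp
qed


section \<open>Matrices with columns in a subspace\<close>

text \<open>
  The condition that all products \<open>M x\<close> lie in the subspace expresses that all columns do, without
  reference to an index.
\<close>

definition columns_in :: "(real^'n) set \<Rightarrow> real^'n^'n \<Rightarrow> bool" where
  "columns_in U M \<longleftrightarrow> (\<forall>x. M *v x \<in> U)"

lemma rank_le_dim_if_columns_in: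
  assumes "columns_in U M"
  shows "rank M \<le> dim U"
  unfolding rank_dim_range using assms by (intro dim_subset) (auto simp: columns_in_def)

lemma columns_in_add:
  assumes "subspace U" "columns_in U M" "columns_in U N"
  shows "columns_in U (M + N)"
  using assms by (simp add: columns_in_def matrix_vector_mult_add_rdistrib subspace_add)

lemma columns_in_scaleR:
  assumes "subspace U" "columns_in U M"
  shows "columns_in U (c *\<^sub>R M)"
  using assms by (simp add: columns_in_def scaleR_matrix_vector_assoc[symmetric] subspace_scale)

lemma columns_in_diff:
  assumes "subspace U" "columns_in U M" "columns_in U N"
  shows "columns_in U (M - N)"
  using assms by (simp add: columns_in_def matrix_vector_mult_diff_rdistrib subspace_diff)

lemma columns_in_lyap:
  assumes "subspace U" "\<And>x. x \<in> U \<Longrightarrow> A *v x \<in> U" "columns_in U X"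
  shows "columns_in U (lyap A X)"
  unfolding lyap_def using assms
  by (intro columns_in_add) (simp_all add: columns_in_def matrix_vector_mul_assoc[symmetric])

lemma columns_in_outer_product:
  fixes b :: "real^'n"
  assumes "subspace U" "b \<in> U"
  shows "columns_in U ((columnvector b :: real^1^'n) ** transpose (columnvector b :: real^1^'n))"
proof -
  have "((columnvector b :: real^1^'n) ** transpose (columnvector b :: real^1^'n)) *v x
      = (b \<bullet> x) *\<^sub>R b" for x
    by (simp add: vec_eq_iff matrix_vector_mult_def matrix_matrix_mult_def columnvector_def
        transpose_def inner_vec_def sum_distrib_left sum_distrib_right mult_ac)
  then show ?thesis
    using assms by (simp add: columns_in_def subspace_scale)
qed

lemma mcg_columns_in:
  assumes U: "subspace U" "\<And>x. x \<in> U \<Longrightarrow> A *v x \<in> U"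
    and F: "columns_in U F" and X0: "columns_in U X0"
  shows "columns_in U (mcg_X A F X0 l) \<and> columns_in U (mcg_R A F X0 l) \<and>
         columns_in U (mcg_P A F X0 l) \<and> columns_in U (mcg_W A F X0 (Suc l))"
proof (induction l)
  case 0
  then show ?case
    using F X0 columns_in_lyap[OF U] columns_in_diff[OF U(1)] by simp
next
  case (Suc l)
  then have X: "columns_in U (mcg_X A F X0 (Suc l))"
    using U(1) by (simp add: columns_in_add columns_in_scaleR del: mcg_W.simps mcg_alpha.simps)
  have R: "columns_in U (mcg_R A F X0 (Suc l))"
    using U(1) Suc by (simp add: columns_in_diff columns_in_scaleR del: mcg_W.simps mcg_alpha.simps)
  have P: "columns_in U (mcg_P A F X0 (Suc l))"
    using U(1) Suc R
    by (simp add: columns_in_add columns_in_scaleR del: mcg_beta.simps mcg_R.simps)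
  then have "columns_in U (mcg_W A F X0 (Suc (Suc l)))"
    unfolding mcg_W.simps by (intro columns_in_lyap U)
  with X R P show ?case by blast
qed


section \<open>The rank bound\<close>

theorem corollary2:
  fixes A F :: "real^'n^'n" and b :: "real^'n" and V :: "nat \<Rightarrow> (real^'n) list"
  assumes A: "sym_pos_def A"
    and F: "F = (columnvector b :: real^1^'n) ** transpose (columnvector b :: real^1^'n)"
    and V: "eigenbases A V"
  shows "\<forall>l. mcg_defined A F 0 l \<longrightarrow>
           rank (mcg_X A F 0 l) \<le> kappa A V b \<and>
           rank (mcg_R A F 0 l) \<le> kappa A V b \<and>
           rank (mcg_P A F 0 l) \<le> kappa A V b \<and>
           (l \<ge> 1 \<longrightarrow> rank (mcg_W A F 0 l) \<le> kappa A V b)"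
proof -
  have sym: "transpose A = A" using A by (simp add: sym_pos_def_def)
  obtain U where U: "subspace U" "\<And>x. x \<in> U \<Longrightarrow> A *v x \<in> U" "b \<in> U"
    and dim: "dim U \<le> kappa A V b"
    using ex_invariant_subspace_dim_le_kappa[OF sym V, of b] by blast
  have "columns_in U F"
    unfolding F by (rule columns_in_outer_product[OF U(1,3)])
  moreover have "columns_in U 0"
    using U(1) by (simp add: columns_in_def subspace_0)
  ultimately have cols: "columns_in U (mcg_X A F 0 l) \<and> columns_in U (mcg_R A F 0 l) \<and>
      columns_in U (mcg_P A F 0 l) \<and> columns_in U (mcg_W A F 0 (Suc l))" for l
    using mcg_columns_in[OF U(1,2)] by blast
  have W: "columns_in U (mcg_W A F 0 l)" if "l \<ge> 1" for l
    using cols[of "l - 1"] that by simp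
  have rank: "rank M \<le> kappa A V b" if "columns_in U M" for M :: "real^'n^'n"
    using rank_le_dim_if_columns_in[OF that] dim by linarith
  show ?thesis
    using cols W rank by blast
qed

end
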